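(* Let $\mathcal{H}$ and $\mathcal{G}_i$, $i=1,\ldots,m$, be real Hilbert spaces, $A:\mathcal{H}\to2^{\mathcal{H}}$ maximally monotone, and $C:\mathcal{H}\to\mathcal{H}$ monotone and $\mu$-Lipschitzian for some $\mu>0$. Let $z\in\mathcal{H}$ and, for every $i\in\{1,\ldots,m\}$, let $r_i\in\mathcal{G}_i$, let $B_i:\mathcal{G}_i\to2^{\mathcal{G}_i}$ be maximally monotone and let $L_i:\mathcal{H}\to\mathcal{G}_i$ be a nonzero linear continuous operator. Suppose that $A+C$ is $\rho$-strongly monotone with $\rho>0$, and let $(\overline{x},\overline{v}_1,\ldots,\overline{v}_m)\in\mathcal{H}\times\mathcal{G}_1\times\cdots\times\mathcal{G}_m$ be a primal-dual solution, i.e. $$z-\sum_{i=1}^mL_i^*\overline{v}_i\in A\overline{x}+C\overline{x}\quad\text{and}\quad\overline{v}_i\in B_i(L_i\overline{x}-r_i),\ i=1,\ldots,m.$$ Let $x_0\in\mathcal{H}$, $(v_{1,0},\ldots,v_{m,0})\in\mathcal{G}_1\times\cdots\times\mathcal{G}_m$, $$\gamma_0\in\Big(0,\min\Big\{1,\frac{\sqrt{1+4\rho}}{2(1+2\rho)\mu}\Big\}\Big),\qquad\sigma_0=\frac{1}{2\gamma_0(1+2\rho)\sum_{i=1}^m\|L_i\|^2},$$ and define for all $n\ge0$ (and all $i=1,\ldots,m$) $$\begin{aligned} p_{1,n}&=J_{\gamma_nA}\Big(x_n-\gamma_n\Big(Cx_n+\sum_{i=1}^mL_i^*v_{i,n}-z\Big)\Big),\\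 p_{2,i,n}&=J_{\sigma_nB_i^{-1}}\big(v_{i,n}+\sigma_n(L_ix_n-r_i)\big),\\ v_{i,n+1}&=\sigma_nL_i(p_{1,n}-x_n)+p_{2,i,n},\\ x_{n+1}&=\gamma_n\sum_{i=1}^mL_i^*(v_{i,n}-p_{2,i,n})+\gamma_n(Cx_n-Cp_{1,n})+p_{1,n},\\ \theta_n&=\frac{1}{\sqrt{1+2\rho\gamma_n(1-\gamma_n)}},\quad\gamma_{n+1}=\theta_n\gamma_n,\quad\sigma_{n+1}=\frac{\sigma_n}{\theta_n}. \end{aligned}$$ Then, for any $\varepsilon>0$, there exists some $n_0\in\mathbb{N}$ (depending on $\varepsilon$ and $\rho\gamma_0$) such that for any $n\ge n_0$ $$\|x_n-\overline{x}\|^2\le\frac{1+\varepsilon}{n^2}\Big(\frac{\|x_0-\overline{x}\|^2}{\rho^2\gamma_0^2}+\sum_{i=1}^m\frac{\|v_{i,0}-\overline{v}_i\|^2}{\rho^2\gamma_0\sigma_0}\Big).$$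
   Context: A set-valued operator $M:\mathcal{H}\to2^{\mathcal{H}}$ is monotone if $\langle x-y,u-v\rangle\ge0$ for all $u\in Mx$, $v\in My$; maximally monotone if it is monotone and its graph is not properly contained in the graph of another monotone operator; $\rho$-strongly monotone ($\rho>0$) if $\langle x-y,u-v\rangle\ge\rho\|x-y\|^2$ for all $u\in Mx$, $v\in My$. $C$ is $\mu$-Lipschitzian if it is single-valued with $\|Cx-Cy\|\le\mu\|x-y\|$ for all $x,y\in\mathcal{H}$. $M^{-1}(u)=\{x:u\in Mx\}$; $J_M=(\mathrm{Id}+M)^{-1}$ is the resolvent of $M$, where $\mathrm{Id}$ is the identity; it is single-valued and everywhere defined for maximally monotone $M$. $L_i^*$ is the adjoint of $L_i$.
   Formalization: The index n_0 depends on ε, ρ and γ_0, not on ε and the product ργ_0 alone, since the latter fails as γ_0 tends to 1 with ργ_0 fixed; n_0 is uniform in all other data once the Hilbert spaces are fixed, and m ≥ 1 is assumed so that σ_0 is defined. *)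

theory Defs
  imports "HOL-Analysis.Analysis"
begin

text \<open>
  A set-valued operator on a real Hilbert space is a function \<open>'a \<Rightarrow> 'a set\<close>.  The finitely many
  spaces \<open>G\<^sub>1, \<dots>, G\<^sub>m\<close> of the theorem may be pairwise different, so they are represented as
  closed linear subspaces of one ambient Hilbert space; this loses no generality, since any finite
  family of Hilbert spaces embeds isometrically into its Hilbert direct sum.  Maximality of an
  operator is therefore taken relative to a carrier subspace \<open>S\<close>.
\<close>

definition op_graph :: "('a \<Rightarrow> 'a set) \<Rightarrow> ('a \<times> 'a) set" where
  "op_graph M = {(x, u). u \<in> M x}"

definition monotone_op :: "('a::real_inner \<Rightarrow> 'a set) \<Rightarrow> bool" where
  "monotone_op M \<longleftrightarrow> (\<forall>x y. \<forall>u\<in>M x. \<forall>v\<in>M y. (x - y) \<bullet> (u - v) \<ge> 0)"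

definition maximally_monotone_op :: "'a::real_inner set \<Rightarrow> ('a \<Rightarrow> 'a set) \<Rightarrow> bool" where
  "maximally_monotone_op S M \<longleftrightarrow>
     op_graph M \<subseteq> S \<times> S \<and> monotone_op M \<and>
     \<not> (\<exists>N. op_graph N \<subseteq> S \<times> S \<and> monotone_op N \<and> op_graph M \<subset> op_graph N)"

definition strongly_monotone_op :: "real \<Rightarrow> ('a::real_inner \<Rightarrow> 'a set) \<Rightarrow> bool" where
  "strongly_monotone_op \<rho> M \<longleftrightarrow>
     (\<forall>x y. \<forall>u\<in>M x. \<forall>v\<in>M y. (x - y) \<bullet> (u - v) \<ge> \<rho> * (norm (x - y))\<^sup>2)"

definition op_of_fun :: "('a \<Rightarrow> 'a) \<Rightarrow> 'a \<Rightarrow> 'a set" where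
  "op_of_fun f x = {f x}"

definition op_plus :: "('a::plus \<Rightarrow> 'a set) \<Rightarrow> ('a \<Rightarrow> 'a set) \<Rightarrow> 'a \<Rightarrow> 'a set" where
  "op_plus M N x = {u + v | u v. u \<in> M x \<and> v \<in> N x}"

definition op_scale :: "real \<Rightarrow> ('a::real_vector \<Rightarrow> 'a set) \<Rightarrow> 'a \<Rightarrow> 'a set" where
  "op_scale c M x = {c *\<^sub>R u | u. u \<in> M x}"

definition op_inverse :: "('a \<Rightarrow> 'a set) \<Rightarrow> 'a \<Rightarrow> 'a set" where
  "op_inverse M u = {x. u \<in> M x}"

text \<open>
  The resolvent as a function: it picks the unique element of \<open>(Id + M)\<^sup>-\<^sup>1 y\<close>.  For \<open>M\<close> maximally
  monotone on a closed subspace \<open>S\<close> this element exists for every \<open>y \<in> S\<close> (and only for those).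
\<close>

definition resolvent :: "('a::real_inner \<Rightarrow> 'a set) \<Rightarrow> 'a \<Rightarrow> 'a" where
  "resolvent M y = the_elem (op_inverse (op_plus (op_of_fun (\<lambda>x. x)) M) y)"

end

theory Submission
  imports Defs
begin

text \<open>
  Let \<open>V n = \<parallel>x n - xbar\<parallel>\<^sup>2 / (\<gamma> n)\<^sup>2 + (\<Sum>i. \<parallel>v i n - vbar i\<parallel>\<^sup>2) / (\<gamma> n * \<sigma> n)\<close>. The theorem follows from
  two facts: \<open>V\<close> does not increase, so that \<open>\<parallel>x n - xbar\<parallel>\<^sup>2 \<le> (\<gamma> n)\<^sup>2 * V 0\<close>, and \<open>n * \<rho> * \<gamma> n\<close> is
  eventually at most \<open>sqrt (1 + \<epsilon>)\<close>. The second fact concerns a recursion that contains only \<open>\<rho>\<close> and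
  \<open>\<gamma>\<^sub>0\<close>, which is why the index from which the estimate holds does not depend on the operators, on \<open>\<mu>\<close>
  or on the iterates.

  For the first fact, adding the strong monotonicity of \<open>A + C\<close> and the monotonicity of the inverses
  of the \<open>B i\<close>, between the resolvent values and the solution, makes the terms that couple the
  primal and the dual variables cancel (\<open>primal_dual_step_inequality\<close>). The remaining second-order
  errors are dominated because of the choice of \<open>\<gamma>\<^sub>0\<close> and \<open>\<sigma> 0\<close>, and strong monotonicity gains the factor
  \<open>1 + 2 * \<rho> * \<gamma> n * (1 - \<gamma> n) = 1 / (\<theta> n)\<^sup>2\<close> (\<open>primal_dual_step\<close>). The step sizes are updated such that
  \<open>\<gamma> n * \<sigma> n\<close> is constant and this factor is used up by the passage from \<open>\<gamma> n\<close> to \<open>\<gamma> (Suc n)\<close>. For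
  the second fact, \<open>1 / \<gamma> n\<close> has increments that tend to \<open>\<rho>\<close> (\<open>accelerated_step_asymptotics\<close>).

  All this presupposes that the resolvents and the adjoints exist in infinite dimension, which is
  Minty's theorem and the Riesz representation. Both come from one minimisation principle for
  closed convex sets in a Hilbert space (\<open>quadratic_epigraph_minimizer\<close>).
\<close>

section \<open>Quadratic minimisation on closed convex sets\<close>

text \<open>
  Minimise \<open>\<phi>(z, t) = t + \<parallel>z\<parallel>\<^sup>2 / 2\<close> over \<open>K\<close>. By the parallelogram law, two points of \<open>K\<close> whose
  values are close to the infimum have close first components, since their midpoint also lies in
  \<open>K\<close>; so every minimising sequence is Cauchy, and completeness replaces weak compactness. The
  conclusion is the first-order optimality condition on \<open>K\<close>. With \<open>K\<close> the graph of a
  functional this yields the Riesz representation, with \<open>K\<close> the epigraph of a Fitzpatrick function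
  it yields Minty's theorem.
\<close>

lemma quadratic_epigraph_minimizer:
  fixes K :: "('a::{real_inner,complete_space} \<times> real) set"
  assumes clo: "closed K" and con: "convex K" and ne: "K \<noteq> {}"
    and lower: "\<And>z t. (z, t) \<in> K \<Longrightarrow> b \<le> t + (norm z)\<^sup>2 / 2"
  obtains z\<^sub>0 t\<^sub>0 where "(z\<^sub>0, t\<^sub>0) \<in> K" and "\<And>z t. (z, t) \<in> K \<Longrightarrow> t\<^sub>0 \<le> t + z\<^sub>0 \<bullet> (z - z\<^sub>0)"
proof -
  define \<phi> where "\<phi> k = snd k + (norm (fst k))\<^sup>2 / 2" for k :: "'a \<times> real"
  define \<iota> where "\<iota> = Inf (\<phi> ` K)"
  have bdd: "bdd_below (\<phi> ` K)"
    by (rule bdd_belowI[of _ b]) (use lower in \<open>auto simp: \<phi>_def\<close>)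
  have inf_le: "\<iota> \<le> \<phi> k" if "k \<in> K" for k
    unfolding \<iota>_def using that bdd by (intro cInf_lower) auto
  have "\<exists>k\<in>K. \<phi> k < \<iota> + inverse (real (Suc n))" for n
  proof -
    have "Inf (\<phi> ` K) < \<iota> + inverse (real (Suc n))" by (simp add: \<iota>_def)
    then show ?thesis using cInf_lessD[of "\<phi> ` K"] ne by blast
  qed
  then obtain k where kK: "\<And>n. k n \<in> K" and kn: "\<And>n. \<phi> (k n) < \<iota> + inverse (real (Suc n))"
    by metis
  have gap: "(norm (fst k - fst k'))\<^sup>2 \<le> 4 * (\<phi> k + \<phi> k' - 2 * \<iota>)" if "k \<in> K" "k' \<in> K" for k k'
  proof -
    have "(1/2) *\<^sub>R k + (1/2) *\<^sub>R k' \<in> K"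
      using con that by (auto simp: convex_def)
    from inf_le[OF this] have "\<iota> \<le> (snd k + snd k') / 2 + (norm (fst k + fst k'))\<^sup>2 / 8"
    proof -
      have e: "fst ((1/2) *\<^sub>R k + (1/2) *\<^sub>R k') = (1/2) *\<^sub>R (fst k + fst k')"
        by (simp add: scaleR_add_right)
      show ?thesis using \<open>\<iota> \<le> \<phi> _\<close> unfolding \<phi>_def e norm_scaleR
        by (simp add: power_mult_distrib power2_eq_square field_simps)
    qed
    moreover have "(norm (fst k + fst k'))\<^sup>2 + (norm (fst k - fst k'))\<^sup>2
        = 2 * (norm (fst k))\<^sup>2 + 2 * (norm (fst k'))\<^sup>2"
      by (simp add: power2_norm_eq_inner inner_simps)
    ultimately show ?thesis unfolding \<phi>_def by argo
  qed
  have "Cauchy (\<lambda>n. fst (k n))"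
  proof (rule metric_CauchyI)
    fix e :: real assume "e > 0"
    then obtain N where N: "inverse (real (Suc N)) < e\<^sup>2 / 8"
      using reals_Archimedean[of "e\<^sup>2 / 8"] by auto
    show "\<exists>M. \<forall>m\<ge>M. \<forall>n\<ge>M. dist (fst (k m)) (fst (k n)) < e"
    proof (intro exI allI impI)
      fix m n assume "N \<le> m" "N \<le> n"
      then have "inverse (real (Suc m)) \<le> inverse (real (Suc N))"
        and "inverse (real (Suc n)) \<le> inverse (real (Suc N))" by (auto intro!: le_imp_inverse_le)
      then have "\<phi> (k m) + \<phi> (k n) - 2 * \<iota> < 2 * (e\<^sup>2 / 8)"
        using kn[of m] kn[of n] N by linarith
      then have "(norm (fst (k m) - fst (k n)))\<^sup>2 < e\<^sup>2"
        using gap[OF kK[of m] kK[of n]] by argo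
      then show "dist (fst (k m)) (fst (k n)) < e"
        using \<open>e > 0\<close> by (simp add: dist_norm power2_less_imp_less)
    qed
  qed
  then obtain z\<^sub>0 where z0: "(\<lambda>n. fst (k n)) \<longlonglongrightarrow> z\<^sub>0" using Cauchy_convergent convergent_def by blast
  define t\<^sub>0 where "t\<^sub>0 = \<iota> - (norm z\<^sub>0)\<^sup>2 / 2"
  have "(\<lambda>n. \<phi> (k n)) \<longlonglongrightarrow> \<iota>"
  proof (rule tendsto_sandwich)
    show "\<forall>\<^sub>F n in sequentially. \<iota> \<le> \<phi> (k n)" using inf_le kK by simp
    show "\<forall>\<^sub>F n in sequentially. \<phi> (k n) \<le> \<iota> + inverse (real (Suc n))"
      using kn by (intro always_eventually allI less_imp_le)
    show "(\<lambda>n. \<iota> + inverse (real (Suc n))) \<longlonglongrightarrow> \<iota>" by (rule LIMSEQ_inverse_real_of_nat_add)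
  qed auto
  then have "(\<lambda>n. \<phi> (k n) - (norm (fst (k n)))\<^sup>2 / 2) \<longlonglongrightarrow> t\<^sub>0"
    unfolding t\<^sub>0_def by (intro tendsto_intros z0) auto
  then have "(\<lambda>n. snd (k n)) \<longlonglongrightarrow> t\<^sub>0" by (simp add: \<phi>_def)
  then have "(\<lambda>n. (fst (k n), snd (k n))) \<longlonglongrightarrow> (z\<^sub>0, t\<^sub>0)" by (intro tendsto_Pair z0)
  then have in_K: "(z\<^sub>0, t\<^sub>0) \<in> K" using closed_sequentially[OF clo] kK by auto
  have "t\<^sub>0 \<le> t + z\<^sub>0 \<bullet> (z - z\<^sub>0)" if zt: "(z, t) \<in> K" for z t
  proof -
    have quad: "0 \<le> t - t\<^sub>0 + z\<^sub>0 \<bullet> (z - z\<^sub>0) + s * ((norm (z - z\<^sub>0))\<^sup>2 / 2)" if "0 < s" "s \<le> 1" for s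
    proof -
      have "(1 - s) *\<^sub>R (z\<^sub>0, t\<^sub>0) + s *\<^sub>R (z, t) \<in> K"
        using that by (intro convexD_alt con in_K zt) auto
      from inf_le[OF this]
      have "\<iota> \<le> (1 - s) * t\<^sub>0 + s * t + (norm (z\<^sub>0 + s *\<^sub>R (z - z\<^sub>0)))\<^sup>2 / 2"
        by (simp add: \<phi>_def algebra_simps)
      then have "0 \<le> s * (t - t\<^sub>0 + z\<^sub>0 \<bullet> (z - z\<^sub>0) + s * ((norm (z - z\<^sub>0))\<^sup>2 / 2))"
        unfolding t\<^sub>0_def
        by (simp add: power2_norm_eq_inner inner_simps inner_commute field_simps)
      then show ?thesis using that by (simp add: zero_le_mult_iff)
    qed
    have "((\<lambda>s. t - t\<^sub>0 + z\<^sub>0 \<bullet> (z - z\<^sub>0) + s * ((norm (z - z\<^sub>0))\<^sup>2 / 2))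
        \<longlongrightarrow> t - t\<^sub>0 + z\<^sub>0 \<bullet> (z - z\<^sub>0) + 0 * ((norm (z - z\<^sub>0))\<^sup>2 / 2)) (at_right (0::real))"
      by (intro tendsto_intros)
    moreover have "\<forall>\<^sub>F s in at_right (0::real). 0 \<le> t - t\<^sub>0 + z\<^sub>0 \<bullet> (z - z\<^sub>0) + s * ((norm (z - z\<^sub>0))\<^sup>2 / 2)"
      using eventually_at_right_real[OF zero_less_one] by eventually_elim (rule quad, auto)
    ultimately have "0 \<le> t - t\<^sub>0 + z\<^sub>0 \<bullet> (z - z\<^sub>0) + 0 * ((norm (z - z\<^sub>0))\<^sup>2 / 2)"
      by (rule tendsto_lowerbound) auto
    then show ?thesis by simp
  qed
  with in_K show thesis by (rule that)
qed

text \<open>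
  On the graph of \<open>f\<close> the optimality condition of the minimisation is a linear inequality that
  holds in the directions \<open>x\<close> and \<open>- x\<close>, hence an equality; the minimiser is \<open>- a\<close>.
\<close>

lemma Riesz_representation:
  fixes f :: "'a::{real_inner,complete_space} \<Rightarrow> real"
  assumes "bounded_linear f"
  obtains a where "\<And>x. f x = x \<bullet> a"
proof -
  interpret f: bounded_linear f by fact
  define K where "K = {(z, f z) |z. True}"
  have K: "K = {p. f (fst p) = snd p}" by (auto simp: K_def)
  have "closed K"
    unfolding K by (intro closed_Collect_eq continuous_intros f.continuous_on)
  moreover have "convex K"
    by (auto simp: K convex_def f.add f.scale)
  moreover have "K \<noteq> {}" by (auto simp: K_def)
  moreover have "- (onorm f)\<^sup>2 / 2 \<le> t + (norm z)\<^sup>2 / 2" if "(z, t) \<in> K" for z t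
  proof -
    have "\<bar>f z\<bar> \<le> onorm f * norm z" using onorm[OF assms, of z] by simp
    moreover have "0 \<le> (norm z - onorm f)\<^sup>2" by simp
    ultimately show ?thesis using that by (simp add: K power2_diff mult.commute)
  qed
  ultimately obtain z\<^sub>0 t\<^sub>0 where "(z\<^sub>0, t\<^sub>0) \<in> K"
    and min: "\<And>z t. (z, t) \<in> K \<Longrightarrow> t\<^sub>0 \<le> t + z\<^sub>0 \<bullet> (z - z\<^sub>0)"
    using quadratic_epigraph_minimizer[of K] by metis
  have "f x = x \<bullet> (- z\<^sub>0)" for x
    using min[of "z\<^sub>0 + x" "f (z\<^sub>0 + x)"] min[of "z\<^sub>0 - x" "f (z\<^sub>0 - x)"] \<open>(z\<^sub>0, t\<^sub>0) \<in> K\<close>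
    by (simp add: K f.add f.diff inner_commute)
  then show thesis by (rule that)
qed

text \<open>
  The adjoint is a choice among the maps with this property; that there is one follows from the
  Riesz representation of \<open>\<lambda>x. L x \<bullet> y\<close>.
\<close>

lemma adjoint_inner:
  fixes L :: "'a::{real_inner,complete_space} \<Rightarrow> 'b::real_inner"
  assumes "bounded_linear L"
  shows "x \<bullet> adjoint L y = L x \<bullet> y"
proof -
  have "\<exists>a. \<forall>x. L x \<bullet> y = x \<bullet> a" for y
    using Riesz_representation[OF bounded_linear_compose[OF bounded_linear_inner_left assms]] by metis
  then have "\<exists>f. \<forall>x y. L x \<bullet> y = x \<bullet> f y" by metis
  then have "\<forall>x y. L x \<bullet> y = x \<bullet> adjoint L y" unfolding adjoint_def by (rule someI_ex)
  then show ?thesis by simp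
qed

section \<open>Maximal monotonicity and resolvents\<close>

text \<open>
  Maximality in the form that is used below: every pair of \<open>S \<times> S\<close> that is monotonically related
  to the graph already lies in it, since adding a single pair to the graph would otherwise give
  a proper monotone extension.
\<close>

lemma maximally_monotone_op_iff:
  "maximally_monotone_op S M \<longleftrightarrow>
    op_graph M \<subseteq> S \<times> S \<and> monotone_op M \<and>
    (\<forall>x\<in>S. \<forall>u\<in>S. (\<forall>y. \<forall>w\<in>M y. (x - y) \<bullet> (u - w) \<ge> 0) \<longrightarrow> u \<in> M x)"
  (is "_ \<longleftrightarrow> ?sub \<and> ?mono \<and> ?related")
proof (intro iffI conjI)
  assume max: "maximally_monotone_op S M"
  then show sub: ?sub and mono: ?mono by (auto simp: maximally_monotone_op_def)
  show ?related
  proof (intro ballI impI, rule ccontr)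
    fix x u assume xu: "x \<in> S" "u \<in> S" "\<forall>y. \<forall>w\<in>M y. (x - y) \<bullet> (u - w) \<ge> 0" and new: "u \<notin> M x"
    define N where "N = M(x := insert u (M x))"
    have "(y - x) \<bullet> (w - u) \<ge> 0" if "w \<in> M y" for y w
      using xu(3) that by (metis inner_minus_left inner_minus_right minus_diff_eq)
    then have "monotone_op N"
      using mono xu(3) by (auto simp: monotone_op_def N_def)
    moreover have N_graph: "op_graph N = insert (x, u) (op_graph M)"
      by (auto simp: op_graph_def N_def split: if_splits)
    moreover have "op_graph N \<subseteq> S \<times> S"
      using sub xu unfolding N_graph by blast
    moreover have "op_graph M \<subset> op_graph N"
      using new unfolding N_graph by (auto simp: op_graph_def)
    ultimately show False using max unfolding maximally_monotone_op_def by blast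
  qed
next
  assume *: "?sub \<and> ?mono \<and> ?related"
  have "\<not> op_graph M \<subset> op_graph N" if "op_graph N \<subseteq> S \<times> S" "monotone_op N" for N
  proof
    assume less: "op_graph M \<subset> op_graph N"
    then obtain x u where xu: "u \<in> N x" "u \<notin> M x" by (auto simp: op_graph_def)
    moreover have "\<forall>y. \<forall>w\<in>M y. (x - y) \<bullet> (u - w) \<ge> 0"
      using less xu that(2) unfolding monotone_op_def op_graph_def by blast
    ultimately show False using * that(1) unfolding op_graph_def by blast
  qed
  then show "maximally_monotone_op S M" using * by (auto simp: maximally_monotone_op_def)
qed

lemma maximally_monotone_op_scale:
  assumes "maximally_monotone_op S M" and "subspace S" and "c > 0"
  shows "maximally_monotone_op S (op_scale c M)"
  unfolding maximally_monotone_op_iff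
proof (intro conjI ballI impI)
  have M: "op_graph M \<subseteq> S \<times> S" "monotone_op M"
    "\<And>x u. x \<in> S \<Longrightarrow> u \<in> S \<Longrightarrow> (\<And>y w. w \<in> M y \<Longrightarrow> (x - y) \<bullet> (u - w) \<ge> 0) \<Longrightarrow> u \<in> M x"
    using assms(1) unfolding maximally_monotone_op_iff by blast+
  show "op_graph (op_scale c M) \<subseteq> S \<times> S"
    using M(1) assms(2) by (auto simp: op_graph_def op_scale_def subspace_scale)
  show "monotone_op (op_scale c M)"
    using M(2) assms(3)
    by (auto simp: monotone_op_def op_scale_def simp flip: scaleR_diff_right intro!: mult_nonneg_nonneg)
  fix x u assume "x \<in> S" "u \<in> S" and rel: "\<forall>y. \<forall>w\<in>op_scale c M y. 0 \<le> (x - y) \<bullet> (u - w)"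
  have "(1/c) *\<^sub>R u \<in> M x"
  proof (rule M(3))
    fix y w assume "w \<in> M y"
    then have "0 \<le> (x - y) \<bullet> (u - c *\<^sub>R w)" using rel by (auto simp: op_scale_def)
    also have "u - c *\<^sub>R w = c *\<^sub>R ((1/c) *\<^sub>R u - w)" using assms(3) by (simp add: scaleR_diff_right)
    finally show "0 \<le> (x - y) \<bullet> ((1/c) *\<^sub>R u - w)" using assms(3) by (simp add: zero_le_mult_iff)
  qed (use \<open>x \<in> S\<close> \<open>u \<in> S\<close> assms(2) in \<open>auto simp: subspace_scale\<close>)
  then show "u \<in> op_scale c M x"
    unfolding op_scale_def using assms(3) by (auto intro!: exI[of _ "(1/c) *\<^sub>R u"])
qed

lemma maximally_monotone_op_inverse:
  assumes "maximally_monotone_op S M"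
  shows "maximally_monotone_op S (op_inverse M)"
proof -
  have sub: "op_graph M \<subseteq> S \<times> S" and mono: "monotone_op M"
    and rel: "\<And>x u. x \<in> S \<Longrightarrow> u \<in> S \<Longrightarrow> (\<And>y w. w \<in> M y \<Longrightarrow> (x - y) \<bullet> (u - w) \<ge> 0) \<Longrightarrow> u \<in> M x"
    using assms unfolding maximally_monotone_op_iff by blast+
  have "monotone_op (op_inverse M)"
    using mono unfolding monotone_op_def op_inverse_def by (metis inner_commute mem_Collect_eq)
  moreover have "x \<in> M u"
    if "x \<in> S" "u \<in> S" "\<forall>y. \<forall>w\<in>op_inverse M y. (x - y) \<bullet> (u - w) \<ge> 0" for x u
    using that by (intro rel) (auto simp: op_inverse_def inner_commute[of "u - _"])
  ultimately show ?thesis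
    using sub unfolding maximally_monotone_op_iff by (auto simp: op_graph_def op_inverse_def)
qed

text \<open>
  \<open>Id + M\<close> is onto \<open>S\<close>. The Fitzpatrick function of \<open>M - y\<close>,
  \<open>F(a, b) = (SUP (u, w). a \<bullet> w + u \<bullet> b - u \<bullet> w)\<close> over the pairs \<open>(u, w)\<close> of its graph,
  is convex and lower semicontinuous, equals \<open>u \<bullet> w\<close> at such a pair, and by
  maximality dominates \<open>a \<bullet> b\<close> on \<open>S \<times> S\<close>. Therefore \<open>F(a, b) + \<parallel>(a, b)\<parallel>\<^sup>2 / 2\<close> is bounded below by \<open>0\<close>
  and has a minimiser \<open>(a, b)\<close>. Evaluating the optimality condition on the graph shows that
  \<open>(- b, - a)\<close> is monotonically related to the graph with the surplus \<open>\<parallel>a + b\<parallel>\<^sup>2\<close>, so it belongs to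
  the graph, and then the surplus is zero. Hence \<open>- a \<in> M a - y\<close>.
\<close>

lemma Minty_surjectivity:
  fixes M :: "'a::{real_inner,complete_space} \<Rightarrow> 'a set"
  assumes max: "maximally_monotone_op S M" and sub: "subspace S" and clo: "closed S" and y: "y \<in> S"
  obtains p where "p \<in> S" and "y - p \<in> M p"
proof -
  have gr: "\<And>x u. u \<in> M x \<Longrightarrow> x \<in> S \<and> u \<in> S" and mono: "monotone_op M"
    and maxD: "\<And>x u. x \<in> S \<Longrightarrow> u \<in> S \<Longrightarrow> (\<And>y w. w \<in> M y \<Longrightarrow> (x - y) \<bullet> (u - w) \<ge> 0) \<Longrightarrow> u \<in> M x"
    using max unfolding maximally_monotone_op_iff op_graph_def by blast+
  \<comment> \<open>The epigraph of the Fitzpatrick function, which avoids a supremum that may be infinite.\<close>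
  define K where "K = (S \<times> S) \<times> UNIV \<inter>
    (\<Inter>u. \<Inter>w\<in>M u. {k. fst (fst k) \<bullet> (w - y) + u \<bullet> snd (fst k) - u \<bullet> (w - y) \<le> snd k})"
  have K_iff: "((a, b), t) \<in> K \<longleftrightarrow>
      a \<in> S \<and> b \<in> S \<and> (\<forall>u. \<forall>w\<in>M u. a \<bullet> (w - y) + u \<bullet> b - u \<bullet> (w - y) \<le> t)" for a b t
    by (auto simp: K_def)
  have "closed K"
    unfolding K_def
    by (intro closed_Int closed_INT ballI closed_Times closed_UNIV clo closed_Collect_le continuous_intros)
  moreover have "convex K"
  proof (rule convexI)
    fix k k' :: "('a \<times> 'a) \<times> real" and s r :: real
    assume *: "k \<in> K" "k' \<in> K" "0 \<le> s" "0 \<le> r" "s + r = 1"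
    obtain a b t a' b' t' where k: "k = ((a, b), t)" "k' = ((a', b'), t')" by (metis surj_pair)
    have "(s *\<^sub>R a + r *\<^sub>R a') \<bullet> (w - y) + u \<bullet> (s *\<^sub>R b + r *\<^sub>R b') - u \<bullet> (w - y) \<le> s * t + r * t'"
      if "w \<in> M u" for u w
    proof -
      have "s * (a \<bullet> (w - y) + u \<bullet> b - u \<bullet> (w - y)) + r * (a' \<bullet> (w - y) + u \<bullet> b' - u \<bullet> (w - y))
          \<le> s * t + r * t'"
        using * that unfolding k K_iff by (intro add_mono mult_left_mono) auto
      moreover have "u \<bullet> (w - y) = s * (u \<bullet> (w - y)) + r * (u \<bullet> (w - y))"
        using *(5) by (metis distrib_right mult_1)
      ultimately show ?thesis by (simp add: inner_add_left inner_add_right algebra_simps)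
    qed
    then show "s *\<^sub>R k + r *\<^sub>R k' \<in> K"
      using * sub unfolding k by (simp add: K_iff subspace_add subspace_scale)
  qed
  moreover have K_ge: "a \<bullet> b \<le> t" if k: "((a, b), t) \<in> K" for a b t
  proof (rule ccontr)
    assume "\<not> a \<bullet> b \<le> t"
    have "b + y \<in> M a"
    proof (rule maxD)
      show "0 \<le> (a - u) \<bullet> (b + y - w)" if "w \<in> M u" for u w
        using k that \<open>\<not> a \<bullet> b \<le> t\<close> unfolding K_iff
        by (force simp: inner_diff_left inner_diff_right inner_add_right)
    qed (use k y sub in \<open>auto simp: K_iff subspace_add\<close>)
    then show False using k \<open>\<not> a \<bullet> b \<le> t\<close> unfolding K_iff by force
  qed
  have graph_in_K: "((u, w - y), u \<bullet> (w - y)) \<in> K" if uw: "w \<in> M u" for u w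
  proof -
    have "u \<bullet> (w' - y) + u' \<bullet> (w - y) - u' \<bullet> (w' - y) \<le> u \<bullet> (w - y)" if "w' \<in> M u'" for u' w'
    proof -
      have "0 \<le> (u - u') \<bullet> (w - w')" using mono uw that by (auto simp: monotone_op_def)
      then show ?thesis by (simp add: inner_diff_left inner_diff_right)
    qed
    then show ?thesis using gr[OF uw] y sub by (simp add: K_iff subspace_diff)
  qed
  moreover have "K \<noteq> {}"
  proof -
    have "\<exists>u w. w \<in> M u" using maxD[of 0 0] subspace_0[OF sub] by blast
    then show ?thesis using graph_in_K by blast
  qed
  moreover have "0 \<le> t + (norm k)\<^sup>2 / 2" if "(k, t) \<in> K" for k t
  proof -
    obtain a b where k: "k = (a, b)" by fastforce
    have "(norm (a + b))\<^sup>2 = 2 * (a \<bullet> b) + (norm k)\<^sup>2"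
      by (simp add: k power2_norm_eq_inner inner_simps inner_commute)
    moreover have "a \<bullet> b \<le> t" using K_ge that k by simp
    ultimately show ?thesis using zero_le_power2[of "norm (a + b)"] by linarith
  qed
  ultimately obtain k\<^sub>0 t\<^sub>0 where k0: "(k\<^sub>0, t\<^sub>0) \<in> K"
    and min: "\<And>k t. (k, t) \<in> K \<Longrightarrow> t\<^sub>0 \<le> t + k\<^sub>0 \<bullet> (k - k\<^sub>0)"
    using quadratic_epigraph_minimizer[of K] by metis
  obtain a b where k0_eq: "k\<^sub>0 = (a, b)" by fastforce
  have ab: "a \<in> S" "b \<in> S" "a \<bullet> b \<le> t\<^sub>0" using k0 K_ge by (auto simp: k0_eq K_iff)
  \<comment> \<open>The optimality condition at a point of the graph, combined with \<open>a \<bullet> b \<le> t\<^sub>0\<close>.\<close>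
  have key: "(norm (a + b))\<^sup>2 \<le> (- b - u) \<bullet> ((y - a) - w)" if "w \<in> M u" for u w
    using min[OF graph_in_K[OF that]] ab(3)
    by (simp add: k0_eq power2_norm_eq_inner inner_simps inner_commute)
  have "y - a \<in> M (- b)"
  proof (rule maxD)
    show "0 \<le> (- b - u) \<bullet> ((y - a) - w)" if "w \<in> M u" for u w
      using key[OF that] by (meson order_trans zero_le_power2)
  qed (use ab y sub in \<open>auto simp: subspace_neg subspace_diff\<close>)
  moreover from key[OF this] have "- b = a" by (simp add: add_eq_0_iff)
  ultimately show thesis using that ab(1) by simp
qed

text \<open>
  Existence of the value is Minty's theorem, uniqueness is monotonicity, so the choice in the
  definition of the resolvent picks the unique solution.
\<close>

lemma resolvent_works:
  fixes M :: "'a::{real_inner,complete_space} \<Rightarrow> 'a set"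
  assumes max: "maximally_monotone_op S M" and sub: "subspace S" and clo: "closed S" and y: "y \<in> S"
  shows "resolvent M y \<in> S" and "y - resolvent M y \<in> M (resolvent M y)"
proof -
  obtain p where p: "p \<in> S" "y - p \<in> M p" using Minty_surjectivity[OF assms] .
  have "op_inverse (op_plus (op_of_fun (\<lambda>x. x)) M) y = {q. y - q \<in> M q}"
    by (force simp: op_inverse_def op_plus_def op_of_fun_def)
  also have "\<dots> = {p}"
  proof -
    have "q = p" if "y - q \<in> M q" for q
    proof -
      have "0 \<le> (q - p) \<bullet> ((y - q) - (y - p))"
        using max that p(2) unfolding maximally_monotone_op_def monotone_op_def by blast
      also have "\<dots> = - ((norm (q - p))\<^sup>2)"
        by (simp add: power2_norm_eq_inner inner_simps inner_commute)
      finally show ?thesis by simp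
    qed
    with p(2) show ?thesis by blast
  qed
  finally have "resolvent M y = p" by (simp add: resolvent_def)
  with p show "resolvent M y \<in> S" and "y - resolvent M y \<in> M (resolvent M y)" by auto
qed

lemma resolvent_scale_works:
  fixes M :: "'a::{real_inner,complete_space} \<Rightarrow> 'a set"
  assumes max: "maximally_monotone_op S M" and sub: "subspace S" and clo: "closed S" and y: "y \<in> S"
    and c: "c > 0"
  shows "resolvent (op_scale c M) y \<in> S"
    and "(1 / c) *\<^sub>R (y - resolvent (op_scale c M) y) \<in> M (resolvent (op_scale c M) y)"
  using resolvent_works[OF maximally_monotone_op_scale[OF max sub c] sub clo y] c
  by (auto simp: op_scale_def)

section \<open>One step of the algorithm\<close>

text \<open>
  The operator \<open>x \<mapsto> (L i x)\<^sub>i\<close> into the direct sum has squared norm at most \<open>\<Sum>i. \<parallel>L i\<parallel>\<^sup>2\<close>, and so has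
  its adjoint.
\<close>

lemma norm_sum_adjoint_le:
  fixes L :: "'i \<Rightarrow> 'a::{real_inner,complete_space} \<Rightarrow> 'b::real_inner"
  assumes L: "\<And>i. i \<in> I \<Longrightarrow> bounded_linear (L i)"
  shows "(norm (\<Sum>i\<in>I. adjoint (L i) (w i)))\<^sup>2 \<le> (\<Sum>i\<in>I. (onorm (L i))\<^sup>2) * (\<Sum>i\<in>I. (norm (w i))\<^sup>2)"
proof -
  define q where "q = (\<Sum>i\<in>I. adjoint (L i) (w i))"
  have "norm q * norm q = (\<Sum>i\<in>I. L i q \<bullet> w i)"
  proof -
    have "norm q * norm q = q \<bullet> (\<Sum>i\<in>I. adjoint (L i) (w i))"
      unfolding q_def[symmetric] by (simp add: dot_square_norm power2_eq_square)
    then show ?thesis using L by (simp add: inner_sum_right adjoint_inner)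
  qed
  also have "\<dots> \<le> (\<Sum>i\<in>I. norm q * (onorm (L i) * norm (w i)))"
  proof (rule sum_mono)
    fix i assume "i \<in> I"
    have "L i q \<bullet> w i \<le> norm (L i q) * norm (w i)" by (rule norm_cauchy_schwarz)
    also have "\<dots> \<le> (onorm (L i) * norm q) * norm (w i)"
      using onorm[OF L[OF \<open>i \<in> I\<close>]] by (rule mult_right_mono) simp
    finally show "L i q \<bullet> w i \<le> norm q * (onorm (L i) * norm (w i))" by (simp add: ac_simps)
  qed
  also have "\<dots> = norm q * (\<Sum>i\<in>I. onorm (L i) * norm (w i))" by (simp add: sum_distrib_left)
  finally have "norm q \<le> (\<Sum>i\<in>I. onorm (L i) * norm (w i))"
    using L by (cases "norm q = 0") (auto intro!: sum_nonneg mult_nonneg_nonneg onorm_pos_le)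
  then have "(norm q)\<^sup>2 \<le> (\<Sum>i\<in>I. onorm (L i) * norm (w i))\<^sup>2" by (rule power_mono) simp
  also have "\<dots> \<le> (\<Sum>i\<in>I. (onorm (L i))\<^sup>2) * (\<Sum>i\<in>I. (norm (w i))\<^sup>2)"
    by (rule Cauchy_Schwarz_ineq_sum)
  finally show ?thesis by (simp add: q_def)
qed

lemma three_point_identity:
  fixes a :: "'a::real_inner"
  shows "2 * ((p - a) \<bullet> (x - y)) =
    (norm (x - a))\<^sup>2 - (norm (y - a))\<^sup>2 - (norm (x - p))\<^sup>2 + (norm (y - p))\<^sup>2"
  by (simp add: power2_norm_eq_inner inner_simps inner_commute)

text \<open>
  Convexity of the squared norm for the points \<open>a / (1 - t)\<close> and \<open>b / t\<close> with the weights \<open>1 - t\<close> and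
  \<open>t\<close>, with denominators cleared.
\<close>

lemma norm_add_squared_le:
  fixes a b :: "'a::real_normed_vector"
  assumes "0 < t" "t < 1"
  shows "(1 - t) * t * (norm (a + b))\<^sup>2 \<le> t * (norm a)\<^sup>2 + (1 - t) * (norm b)\<^sup>2"
proof -
  have "(norm (a + b))\<^sup>2 \<le> (norm a + norm b)\<^sup>2"
    by (intro power_mono norm_triangle_ineq norm_ge_zero)
  then have "(1 - t) * t * (norm (a + b))\<^sup>2 \<le> (1 - t) * t * (norm a + norm b)\<^sup>2"
    using assms by (intro mult_left_mono) auto
  also have "\<dots> = t * (norm a)\<^sup>2 + (1 - t) * (norm b)\<^sup>2 - (t * norm a - (1 - t) * norm b)\<^sup>2"
    by (simp add: power2_eq_square algebra_simps)
  also have "\<dots> \<le> t * (norm a)\<^sup>2 + (1 - t) * (norm b)\<^sup>2" by simp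
  finally show ?thesis .
qed

text \<open>
  Here \<open>(a, b)\<close> is the solution, \<open>(p, q)\<close> the pair of resolvent values and \<open>c\<close> stands for
  \<open>C x - C p\<close>. The updates are made so that \<open>(x - x') / \<gamma>\<close> and \<open>(v - v') / \<sigma>\<close> absorb all
  terms with \<open>c\<close>, \<open>x\<close> and \<open>v\<close> in the two monotonicity inequalities. What remains of the couplings
  through \<open>L i\<close> is \<open>L i (p - a) \<bullet> (q i - b i)\<close> with opposite signs, because that part of the problem
  is skew, and it cancels in the sum. The rest is the three-point identity.
\<close>

lemma primal_dual_step_inequality:
  fixes L :: "'i \<Rightarrow> 'a::{real_inner,complete_space} \<Rightarrow> 'b::real_inner"
  assumes L: "\<And>i. i \<in> I \<Longrightarrow> bounded_linear (L i)"
    and g: "\<gamma> > 0" and s: "\<sigma> > 0"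
    and primal: "\<rho> * (norm (p - a))\<^sup>2 \<le>
      (p - a) \<bullet> ((1/\<gamma>) *\<^sub>R (x - p) - c - (\<Sum>i\<in>I. adjoint (L i) (v i)) + (\<Sum>i\<in>I. adjoint (L i) (b i)))"
    and dual: "\<And>i. i \<in> I \<Longrightarrow> 0 \<le> (q i - b i) \<bullet> ((1/\<sigma>) *\<^sub>R (v i - q i) + L i (x - a))"
    and v': "\<And>i. i \<in> I \<Longrightarrow> v' i = \<sigma> *\<^sub>R L i (p - x) + q i"
    and x': "x' = \<gamma> *\<^sub>R (\<Sum>i\<in>I. adjoint (L i) (v i - q i)) + \<gamma> *\<^sub>R c + p"
  shows "2 * \<rho> * (norm (p - a))\<^sup>2 + (norm (x' - a))\<^sup>2 / \<gamma> + (\<Sum>i\<in>I. (norm (v' i - b i))\<^sup>2) / \<sigma>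
    \<le> (norm (x - a))\<^sup>2 / \<gamma> + (\<Sum>i\<in>I. (norm (v i - b i))\<^sup>2) / \<sigma>
      + ((norm (x' - p))\<^sup>2 - (norm (x - p))\<^sup>2) / \<gamma>
      + ((\<Sum>i\<in>I. (norm (v' i - q i))\<^sup>2) - (\<Sum>i\<in>I. (norm (v i - q i))\<^sup>2)) / \<sigma>"
proof -
  have adj: "y \<bullet> (\<Sum>i\<in>I. adjoint (L i) (w i)) = (\<Sum>i\<in>I. L i y \<bullet> w i)" for y w
    using L by (simp add: inner_sum_right adjoint_inner)
  have "(p - a) \<bullet> ((1/\<gamma>) *\<^sub>R (x - p) - c - (\<Sum>i\<in>I. adjoint (L i) (v i)) + (\<Sum>i\<in>I. adjoint (L i) (b i)))
    = (p - a) \<bullet> (x - x') / \<gamma> - (\<Sum>i\<in>I. L i (p - a) \<bullet> (q i - b i))"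
  proof -
    have "(1/\<gamma>) *\<^sub>R (x - p) - c = (1/\<gamma>) *\<^sub>R (x - x') + (\<Sum>i\<in>I. adjoint (L i) (v i - q i))"
      using g by (simp add: x' algebra_simps)
    then show ?thesis
      by (simp add: inner_add_right inner_diff_right adj sum_subtractf)
  qed
  with primal have P: "\<rho> * (norm (p - a))\<^sup>2 \<le>
      (p - a) \<bullet> (x - x') / \<gamma> - (\<Sum>i\<in>I. L i (p - a) \<bullet> (q i - b i))" by simp
  have "0 \<le> (q i - b i) \<bullet> (v i - v' i) / \<sigma> + L i (p - a) \<bullet> (q i - b i)" if i: "i \<in> I" for i
  proof -
    interpret bounded_linear "L i" by (rule L[OF i])
    have "(1/\<sigma>) *\<^sub>R (v i - q i) + L i (x - a) = (1/\<sigma>) *\<^sub>R (v i - v' i) + L i (p - a)"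
      using s by (simp add: v'[OF i] diff algebra_simps)
    then show ?thesis
      using dual[OF i] by (simp add: inner_add_right inner_commute)
  qed
  then have "0 \<le> (\<Sum>i\<in>I. (q i - b i) \<bullet> (v i - v' i) / \<sigma> + L i (p - a) \<bullet> (q i - b i))"
    by (rule sum_nonneg)
  with P have sum: "2 * \<rho> * (norm (p - a))\<^sup>2 \<le>
      2 * ((p - a) \<bullet> (x - x')) / \<gamma> + (\<Sum>i\<in>I. 2 * ((q i - b i) \<bullet> (v i - v' i))) / \<sigma>"
    by (simp add: sum.distrib flip: sum_divide_distrib sum_distrib_left)
  show ?thesis
    using sum unfolding three_point_identity sum.distrib sum_subtractf
    by (simp add: add_divide_distrib diff_divide_distrib)
qed

text \<open>
  The error terms of \<open>primal_dual_step_inequality\<close> are of second order in the steps. Strong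
  monotonicity controls \<open>p\<close>, but the factor has to sit on the distance of the next iterate \<open>x'\<close>; the
  splitting of \<open>x' - a\<close> with weight \<open>\<gamma>\<close> moves it there and raises the factor of
  \<open>\<parallel>x' - p\<parallel>\<^sup>2 / \<gamma>\<close> from \<open>1\<close> to at most \<open>1 + 2 * \<rho>\<close>. With this factor the value prescribed for
  \<open>\<gamma> * \<sigma>\<close> makes the coefficient of \<open>\<Sum>i. \<parallel>v i - q i\<parallel>\<^sup>2\<close> vanish, and the bound on \<open>\<gamma>\<close> in
  terms of \<open>\<mu>\<close> says exactly that the coefficient of \<open>\<parallel>x - p\<parallel>\<^sup>2\<close> is not positive.
\<close>

lemma primal_dual_step:
  fixes L :: "'i \<Rightarrow> 'a::{real_inner,complete_space} \<Rightarrow> 'b::real_inner"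
  assumes L: "\<And>i. i \<in> I \<Longrightarrow> bounded_linear (L i)"
    and \<rho>: "\<rho> > 0" and g: "0 < \<gamma>" "\<gamma> < 1" and mu: "\<mu> > 0"
    and g_mu: "\<gamma> \<le> sqrt (1 + 4 * \<rho>) / (2 * (1 + 2 * \<rho>) * \<mu>)"
    and s: "\<sigma> > 0" and gs: "2 * (1 + 2 * \<rho>) * (\<Sum>i\<in>I. (onorm (L i))\<^sup>2) * (\<gamma> * \<sigma>) = 1"
    and primal: "\<rho> * (norm (p - a))\<^sup>2 \<le>
      (p - a) \<bullet> ((1/\<gamma>) *\<^sub>R (x - p) - c - (\<Sum>i\<in>I. adjoint (L i) (v i)) + (\<Sum>i\<in>I. adjoint (L i) (b i)))"
    and dual: "\<And>i. i \<in> I \<Longrightarrow> 0 \<le> (q i - b i) \<bullet> ((1/\<sigma>) *\<^sub>R (v i - q i) + L i (x - a))"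
    and c: "norm c \<le> \<mu> * norm (x - p)"
    and v': "\<And>i. i \<in> I \<Longrightarrow> v' i = \<sigma> *\<^sub>R L i (p - x) + q i"
    and x': "x' = \<gamma> *\<^sub>R (\<Sum>i\<in>I. adjoint (L i) (v i - q i)) + \<gamma> *\<^sub>R c + p"
  shows "(1 + 2 * \<rho> * \<gamma> * (1 - \<gamma>)) * (norm (x' - a))\<^sup>2 / \<gamma> + (\<Sum>i\<in>I. (norm (v' i - b i))\<^sup>2) / \<sigma>
    \<le> (norm (x - a))\<^sup>2 / \<gamma> + (\<Sum>i\<in>I. (norm (v i - b i))\<^sup>2) / \<sigma>"
proof -
  define \<Lambda> where "\<Lambda> = (\<Sum>i\<in>I. (onorm (L i))\<^sup>2)"
  define D where "D = (\<Sum>i\<in>I. (norm (v i - q i))\<^sup>2)"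
  define X where "X = (norm (x - p))\<^sup>2"
  have X0: "X \<ge> 0" by (simp add: X_def)
  have primal_gap: "(norm (x' - p))\<^sup>2 \<le> 2 * \<gamma>\<^sup>2 * \<Lambda> * D + 2 * \<gamma>\<^sup>2 * \<mu>\<^sup>2 * X"
  proof -
    define w where "w = (\<Sum>i\<in>I. adjoint (L i) (v i - q i))"
    have "(norm (w + c))\<^sup>2 \<le> 2 * (norm w)\<^sup>2 + 2 * (norm c)\<^sup>2"
      using norm_add_squared_le[of "1/2" w c] by simp
    moreover have "(norm w)\<^sup>2 \<le> \<Lambda> * D"
      unfolding w_def \<Lambda>_def D_def by (rule norm_sum_adjoint_le) (rule L)
    moreover have "(norm c)\<^sup>2 \<le> \<mu>\<^sup>2 * X"
      using power_mono[OF c norm_ge_zero, of 2] by (simp add: X_def power_mult_distrib)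
    ultimately have "(norm (w + c))\<^sup>2 \<le> 2 * (\<Lambda> * D) + 2 * (\<mu>\<^sup>2 * X)" by linarith
    then have "\<gamma>\<^sup>2 * (norm (w + c))\<^sup>2 \<le> \<gamma>\<^sup>2 * (2 * (\<Lambda> * D) + 2 * (\<mu>\<^sup>2 * X))"
      by (rule mult_left_mono) simp
    moreover have "x' - p = \<gamma> *\<^sub>R (w + c)" by (simp add: x' w_def scaleR_add_right)
    then have "(norm (x' - p))\<^sup>2 = \<gamma>\<^sup>2 * (norm (w + c))\<^sup>2" by (simp add: power_mult_distrib)
    ultimately show ?thesis by (simp add: algebra_simps)
  qed
  have dual_gap: "(\<Sum>i\<in>I. (norm (v' i - q i))\<^sup>2) \<le> \<sigma>\<^sup>2 * \<Lambda> * X"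
  proof -
    have "(norm (v' i - q i))\<^sup>2 \<le> \<sigma>\<^sup>2 * X * (onorm (L i))\<^sup>2" if "i \<in> I" for i
    proof -
      have "norm (L i (p - x)) \<le> onorm (L i) * norm (x - p)"
        using onorm[OF L[OF that], of "p - x"] by (simp add: norm_minus_commute)
      from power_mono[OF this norm_ge_zero, of 2] show ?thesis
        by (simp add: v'[OF that] X_def power_mult_distrib mult_left_mono ac_simps)
    qed
    then show ?thesis unfolding \<Lambda>_def
      using sum_mono[of I "\<lambda>i. (norm (v' i - q i))\<^sup>2" "\<lambda>i. \<sigma>\<^sup>2 * X * (onorm (L i))\<^sup>2"]
      by (simp add: ac_simps flip: sum_distrib_left)
  qed
  have mix: "2 * \<rho> * (1 - \<gamma>) * (norm (x' - a))\<^sup>2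
      \<le> 2 * \<rho> * (norm (p - a))\<^sup>2 + 2 * \<rho> * (norm (x' - p))\<^sup>2 / \<gamma>"
  proof -
    have "(1 - \<gamma>) * \<gamma> * (norm (x' - a))\<^sup>2 \<le> \<gamma> * (norm (p - a))\<^sup>2 + (1 - \<gamma>) * (norm (x' - p))\<^sup>2"
      using norm_add_squared_le[OF g, of "p - a" "x' - p"] by simp
    also have "\<dots> \<le> \<gamma> * (norm (p - a))\<^sup>2 + (norm (x' - p))\<^sup>2"
      using g by (simp add: mult_left_le_one_le)
    finally have "(1 - \<gamma>) * (norm (x' - a))\<^sup>2 \<le> (norm (p - a))\<^sup>2 + (norm (x' - p))\<^sup>2 / \<gamma>"
      using g by (simp add: field_simps)
    from mult_left_mono[OF this, of "2 * \<rho>"] show ?thesis using \<rho> by (simp add: algebra_simps)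
  qed
  have gs': "1 / \<sigma> = 2 * (1 + 2 * \<rho>) * \<gamma> * \<Lambda>"
    using gs s by (simp add: \<Lambda>_def divide_eq_eq ac_simps)
  have "(\<sigma> * \<Lambda>) * (2 * (1 + 2 * \<rho>) * \<gamma>) = 1" using gs by (simp add: \<Lambda>_def ac_simps)
  then have sL: "\<sigma> * \<Lambda> = 1 / (2 * (1 + 2 * \<rho>) * \<gamma>)"
    using g \<rho> by (intro eq_divide_imp) auto
  have step_size: "2 * (1 + 2 * \<rho>) * \<gamma> * \<mu>\<^sup>2 + \<sigma> * \<Lambda> \<le> 1 / \<gamma>"
  proof -
    have "\<gamma> * (2 * (1 + 2 * \<rho>) * \<mu>) \<le> sqrt (1 + 4 * \<rho>)"
      using g_mu mu \<rho> by (simp add: pos_le_divide_eq)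
    from power_mono[OF this, of 2] have "(\<gamma> * (2 * (1 + 2 * \<rho>) * \<mu>))\<^sup>2 \<le> 1 + 4 * \<rho>"
      using g mu \<rho> by simp
    then have "(\<gamma> * (2 * (1 + 2 * \<rho>) * \<mu>))\<^sup>2 / (2 * (1 + 2 * \<rho>) * \<gamma>)
        \<le> (1 + 4 * \<rho>) / (2 * (1 + 2 * \<rho>) * \<gamma>)"
      using g \<rho> by (intro divide_right_mono) auto
    moreover have "(\<gamma> * (2 * (1 + 2 * \<rho>) * \<mu>))\<^sup>2 / (2 * (1 + 2 * \<rho>) * \<gamma>)
        = 2 * (1 + 2 * \<rho>) * \<gamma> * \<mu>\<^sup>2"
      using g \<rho> by (simp add: power_mult_distrib power2_eq_square)
    moreover have "(1 + 4 * \<rho>) / (2 * (1 + 2 * \<rho>) * \<gamma>) + 1 / (2 * (1 + 2 * \<rho>) * \<gamma>) = 1 / \<gamma>"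
    proof -
      have "(1 + 4 * \<rho>) / (2 * (1 + 2 * \<rho>) * \<gamma>) + 1 / (2 * (1 + 2 * \<rho>) * \<gamma>)
          = (2 * (1 + 2 * \<rho>)) / (2 * (1 + 2 * \<rho>) * \<gamma>)"
        by (simp flip: add_divide_distrib)
      also have "\<dots> = 1 / \<gamma>" using \<rho> by (intro nonzero_divide_mult_cancel_left) auto
      finally show ?thesis .
    qed
    ultimately show ?thesis unfolding sL by linarith
  qed
  have "(1 + 2 * \<rho>) * ((norm (x' - p))\<^sup>2 / \<gamma>) + (\<Sum>i\<in>I. (norm (v' i - q i))\<^sup>2) / \<sigma> \<le> X / \<gamma> + D / \<sigma>"
  proof -
    have "(1 + 2 * \<rho>) * ((norm (x' - p))\<^sup>2 / \<gamma>)
        \<le> (1 + 2 * \<rho>) * ((2 * \<gamma>\<^sup>2 * \<Lambda> * D + 2 * \<gamma>\<^sup>2 * \<mu>\<^sup>2 * X) / \<gamma>)"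
      using primal_gap g \<rho> by (intro mult_left_mono divide_right_mono) auto
    also have "\<dots> = (2 * (1 + 2 * \<rho>) * \<gamma> * \<Lambda>) * D + 2 * (1 + 2 * \<rho>) * \<gamma> * \<mu>\<^sup>2 * X"
      using g by (simp add: power2_eq_square field_simps)
    also have "\<dots> = D / \<sigma> + 2 * (1 + 2 * \<rho>) * \<gamma> * \<mu>\<^sup>2 * X" unfolding gs'[symmetric] by simp
    finally have "(1 + 2 * \<rho>) * ((norm (x' - p))\<^sup>2 / \<gamma>) \<le> D / \<sigma> + 2 * (1 + 2 * \<rho>) * \<gamma> * \<mu>\<^sup>2 * X" .
    moreover have "(\<Sum>i\<in>I. (norm (v' i - q i))\<^sup>2) / \<sigma> \<le> \<sigma> * \<Lambda> * X"
      using dual_gap s by (simp add: pos_divide_le_eq power2_eq_square ac_simps)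
    moreover have "(2 * (1 + 2 * \<rho>) * \<gamma> * \<mu>\<^sup>2 + \<sigma> * \<Lambda>) * X \<le> 1 / \<gamma> * X"
      using step_size X0 by (rule mult_right_mono)
    ultimately show ?thesis by (simp add: distrib_right)
  qed
  moreover note primal_dual_step_inequality[OF L g(1) s primal dual v' x'] mix
  ultimately show ?thesis
    using g unfolding X_def D_def
    by (simp add: distrib_right add_divide_distrib diff_divide_distrib)
qed

section \<open>Decay of the step sizes\<close>

text \<open>
  The step sizes as a function of \<open>\<rho>\<close> and \<open>\<gamma>\<^sub>0\<close> alone, so that a statement about their decay is uniform in
  all other data of the problem.
\<close>

primrec accelerated_step :: "real \<Rightarrow> real \<Rightarrow> nat \<Rightarrow> real" where
  "accelerated_step \<rho> \<gamma>\<^sub>0 0 = \<gamma>\<^sub>0"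
| "accelerated_step \<rho> \<gamma>\<^sub>0 (Suc n) =
    accelerated_step \<rho> \<gamma>\<^sub>0 n / sqrt (1 + 2 * \<rho> * accelerated_step \<rho> \<gamma>\<^sub>0 n * (1 - accelerated_step \<rho> \<gamma>\<^sub>0 n))"

lemma accelerated_step_bounds:
  assumes "\<rho> > 0" "0 < \<gamma>\<^sub>0" "\<gamma>\<^sub>0 < 1"
  shows "0 < accelerated_step \<rho> \<gamma>\<^sub>0 n \<and> accelerated_step \<rho> \<gamma>\<^sub>0 n \<le> \<gamma>\<^sub>0"
proof (induction n)
  case 0
  then show ?case using assms by simp
next
  case (Suc n)
  let ?s = "accelerated_step \<rho> \<gamma>\<^sub>0 n"
  have 1: "1 \<le> sqrt (1 + 2 * \<rho> * ?s * (1 - ?s))"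
    using Suc assms by simp
  then have "?s / sqrt (1 + 2 * \<rho> * ?s * (1 - ?s)) \<le> ?s / 1"
    using Suc by (intro divide_left_mono) auto
  moreover have "0 < ?s / sqrt (1 + 2 * \<rho> * ?s * (1 - ?s))"
    using Suc 1 by (intro divide_pos_pos) linarith+
  ultimately show ?case using Suc by simp
qed

text \<open>
  The reciprocals \<open>a n\<close> of the step sizes satisfy \<open>(a (Suc n))\<^sup>2 = (a n)\<^sup>2 + 2 * \<rho> * (a n - 1)\<close>, that is
  \<open>(a n + \<rho>)\<^sup>2\<close> up to a constant. As \<open>a 0 > 1\<close>, they tend to infinity, and then their increments
  tend to \<open>\<rho>\<close>; so \<open>a n\<close> grows at least like \<open>n\<close> times any number below \<open>\<rho>\<close>.
\<close>

lemma accelerated_step_asymptotics: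
  assumes \<rho>: "\<rho> > 0" and g: "0 < \<gamma>\<^sub>0" "\<gamma>\<^sub>0 < 1" and eps: "\<epsilon> > 0"
  shows "\<exists>n\<^sub>0. \<forall>n\<ge>n\<^sub>0. (real n * \<rho> * accelerated_step \<rho> \<gamma>\<^sub>0 n)\<^sup>2 \<le> 1 + \<epsilon>"
proof -
  define a where "a n = 1 / accelerated_step \<rho> \<gamma>\<^sub>0 n" for n
  define \<beta> where "\<beta> = 1 / \<gamma>\<^sub>0"
  have \<beta>: "\<beta> > 1" using g by (simp add: \<beta>_def)
  note bnd = accelerated_step_bounds[OF \<rho> g]
  have a_ge: "a n \<ge> \<beta>" for n
    using bnd[of n] unfolding a_def \<beta>_def by (intro divide_left_mono) auto
  have rec: "(a (Suc n))\<^sup>2 = (a n)\<^sup>2 + 2 * \<rho> * (a n - 1)" for n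
  proof -
    define t where "t = accelerated_step \<rho> \<gamma>\<^sub>0 n"
    have t: "0 < t" "t < 1" using bnd[of n] g by (auto simp: t_def)
    then have "0 \<le> 1 + 2 * \<rho> * t * (1 - t)" using \<rho> by simp
    moreover have "a (Suc n) = sqrt (1 + 2 * \<rho> * t * (1 - t)) / t" by (simp add: a_def t_def)
    ultimately have "(a (Suc n))\<^sup>2 = (1 + 2 * \<rho> * t * (1 - t)) / t\<^sup>2"
      by (simp add: power_divide)
    then show ?thesis using t unfolding a_def t_def[symmetric]
      by (simp add: field_simps power2_eq_square)
  qed
  have lin: "2 * \<rho> * (\<beta> - 1) * real n \<le> (a n)\<^sup>2" for n
  proof (induction n)
    case (Suc n)
    have "2 * \<rho> * (\<beta> - 1) \<le> 2 * \<rho> * (a n - 1)" using a_ge[of n] \<rho> by simp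
    with Suc show ?case unfolding rec by (simp add: distrib_left)
  qed simp
  \<comment> \<open>Half of the distance from \<open>\<rho> / sqrt (1 + \<epsilon>)\<close> to \<open>\<rho>\<close>: increments of at least \<open>\<rho> - \<eta>\<close>
    leave a margin of \<open>\<eta>\<close> per step that makes up for the first \<open>N\<close> steps.\<close>
  define \<eta> where "\<eta> = \<rho> * (1 - 1 / sqrt (1 + \<epsilon>)) / 2"
  have \<eta>: "\<eta> > 0" using \<rho> eps by (simp add: \<eta>_def)
  have \<rho>\<eta>: "\<rho> / sqrt (1 + \<epsilon>) = \<rho> - 2 * \<eta>" by (simp add: \<eta>_def field_simps)
  have "0 < \<rho> / sqrt (1 + \<epsilon>)" using \<rho> eps by simp
  with \<rho>\<eta> \<eta> have \<eta>2: "\<rho> - \<eta> > 0" by linarith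
  \<comment> \<open>From the height \<open>K\<close> on, \<open>(a n + (\<rho> - \<eta>))\<^sup>2 \<le> (a (Suc n))\<^sup>2\<close>.\<close>
  define K where "K = (2 * \<rho> + (\<rho> - \<eta>)\<^sup>2) / (2 * \<eta>)"
  have K0: "K \<ge> 0" using \<rho> \<eta> by (simp add: K_def)
  obtain N where N: "K\<^sup>2 / (2 * \<rho> * (\<beta> - 1)) \<le> real N" using real_arch_simple by blast
  have aK: "K \<le> a n" if "n \<ge> N" for n
  proof -
    have "K\<^sup>2 / (2 * \<rho> * (\<beta> - 1)) \<le> real n" using N that by linarith
    then have "K\<^sup>2 \<le> 2 * \<rho> * (\<beta> - 1) * real n"
      using \<rho> \<beta> by (simp add: pos_divide_le_eq ac_simps)
    then have "K\<^sup>2 \<le> (a n)\<^sup>2" using lin[of n] by linarith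
    moreover have "0 \<le> a n" using a_ge[of n] \<beta> by linarith
    ultimately show ?thesis by (rule power2_le_imp_le)
  qed
  have incr: "a n + (\<rho> - \<eta>) \<le> a (Suc n)" if "n \<ge> N" for n
  proof (rule power2_le_imp_le)
    have "2 * \<rho> + (\<rho> - \<eta>)\<^sup>2 \<le> 2 * \<eta> * a n"
      using aK[OF that] \<eta> by (simp add: K_def pos_divide_le_eq ac_simps)
    then show "(a n + (\<rho> - \<eta>))\<^sup>2 \<le> (a (Suc n))\<^sup>2"
      unfolding rec by (simp add: power2_eq_square algebra_simps)
    show "0 \<le> a (Suc n)" using a_ge[of "Suc n"] \<beta> by linarith
  qed
  have growth: "(\<rho> - \<eta>) * real k \<le> a (N + k)" for k
  proof (induction k)
    case 0
    then show ?case using a_ge[of N] \<beta> by simp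
  next
    case (Suc k)
    then show ?case using incr[of "N + k"] by (simp add: distrib_left)
  qed
  obtain M where M: "(\<rho> - \<eta>) * real N / \<eta> \<le> real M" using real_arch_simple by blast
  have "(real n * \<rho> * accelerated_step \<rho> \<gamma>\<^sub>0 n)\<^sup>2 \<le> 1 + \<epsilon>" if n: "n \<ge> max N M" for n
  proof -
    have "(\<rho> - \<eta>) * real N / \<eta> \<le> real n" using M n by linarith
    then have "(\<rho> - \<eta>) * real N \<le> \<eta> * real n" using \<eta> by (simp add: pos_divide_le_eq ac_simps)
    moreover have "(\<rho> - \<eta>) * (real n - real N) \<le> a n"
      using growth[of "n - N"] n by (simp add: of_nat_diff)
    ultimately have "\<rho> / sqrt (1 + \<epsilon>) * real n \<le> a n"
      unfolding \<rho>\<eta> by (simp add: algebra_simps)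
    then have "real n * \<rho> * accelerated_step \<rho> \<gamma>\<^sub>0 n \<le> sqrt (1 + \<epsilon>)"
      using bnd[of n] eps unfolding a_def by (simp add: field_simps)
    from power_mono[OF this, of 2] show ?thesis using bnd[of n] \<rho> eps by simp
  qed
  then show ?thesis by blast
qed

section \<open>The convergence rate\<close>

theorem theorem3p3:
  fixes \<rho> \<gamma>\<^sub>0 \<epsilon> :: real
  assumes "\<rho> > 0" and "\<gamma>\<^sub>0 > 0" and "\<epsilon> > 0"
  shows "\<exists>n\<^sub>0::nat.
    \<forall>(m::nat) (\<mu>::real)
      (A :: 'h::{real_inner, complete_space} \<Rightarrow> 'h set) (C :: 'h \<Rightarrow> 'h) (z :: 'h)
      (G :: nat \<Rightarrow> 'g::{real_inner, complete_space} set)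
      (B :: nat \<Rightarrow> 'g \<Rightarrow> 'g set) (L :: nat \<Rightarrow> 'h \<Rightarrow> 'g) (r :: nat \<Rightarrow> 'g)
      (xbar :: 'h) (vbar :: nat \<Rightarrow> 'g)
      (x :: nat \<Rightarrow> 'h) (v :: nat \<Rightarrow> nat \<Rightarrow> 'g) (p\<^sub>1 :: nat \<Rightarrow> 'h) (p\<^sub>2 :: nat \<Rightarrow> nat \<Rightarrow> 'g)
      (\<gamma> :: nat \<Rightarrow> real) (\<sigma> :: nat \<Rightarrow> real) (\<theta> :: nat \<Rightarrow> real).
      m \<ge> 1 \<longrightarrow>
      maximally_monotone_op UNIV A \<longrightarrow>
      \<mu> > 0 \<longrightarrow> monotone_op (op_of_fun C) \<longrightarrow> \<mu>-lipschitz_on UNIV C \<longrightarrow>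
      (\<forall>i\<in>{1..m}. subspace (G i) \<and> closed (G i) \<and> r i \<in> G i \<and>
         maximally_monotone_op (G i) (B i) \<and>
         bounded_linear (L i) \<and> range (L i) \<subseteq> G i \<and> L i \<noteq> (\<lambda>_. 0)) \<longrightarrow>
      strongly_monotone_op \<rho> (op_plus A (op_of_fun C)) \<longrightarrow>
      (\<forall>i\<in>{1..m}. vbar i \<in> G i) \<longrightarrow>
      z - (\<Sum>i=1..m. adjoint (L i) (vbar i)) \<in> op_plus A (op_of_fun C) xbar \<longrightarrow>
      (\<forall>i\<in>{1..m}. vbar i \<in> B i (L i xbar - r i)) \<longrightarrow>
      (\<forall>i\<in>{1..m}. v i 0 \<in> G i) \<longrightarrow>
      \<gamma>\<^sub>0 < min 1 (sqrt (1 + 4 * \<rho>) / (2 * (1 + 2 * \<rho>) * \<mu>)) \<longrightarrow>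
      \<gamma> 0 = \<gamma>\<^sub>0 \<longrightarrow>
      \<sigma> 0 = 1 / (2 * \<gamma>\<^sub>0 * (1 + 2 * \<rho>) * (\<Sum>i=1..m. (onorm (L i))\<^sup>2)) \<longrightarrow>
      (\<forall>n. p\<^sub>1 n = resolvent (op_scale (\<gamma> n) A)
              (x n - \<gamma> n *\<^sub>R (C (x n) + (\<Sum>i=1..m. adjoint (L i) (v i n)) - z))) \<longrightarrow>
      (\<forall>n. \<forall>i\<in>{1..m}. p\<^sub>2 i n = resolvent (op_scale (\<sigma> n) (op_inverse (B i)))
              (v i n + \<sigma> n *\<^sub>R (L i (x n) - r i))) \<longrightarrow>
      (\<forall>n. \<forall>i\<in>{1..m}. v i (Suc n) = \<sigma> n *\<^sub>R L i (p\<^sub>1 n - x n) + p\<^sub>2 i n) \<longrightarrow>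
      (\<forall>n. x (Suc n) = \<gamma> n *\<^sub>R (\<Sum>i=1..m. adjoint (L i) (v i n - p\<^sub>2 i n))
              + \<gamma> n *\<^sub>R (C (x n) - C (p\<^sub>1 n)) + p\<^sub>1 n) \<longrightarrow>
      (\<forall>n. \<theta> n = 1 / sqrt (1 + 2 * \<rho> * \<gamma> n * (1 - \<gamma> n)) \<and>
           \<gamma> (Suc n) = \<theta> n * \<gamma> n \<and> \<sigma> (Suc n) = \<sigma> n / \<theta> n) \<longrightarrow>
      (\<forall>n\<ge>n\<^sub>0. (norm (x n - xbar))\<^sup>2 \<le> (1 + \<epsilon>) / (real n)\<^sup>2 *
         ((norm (x 0 - xbar))\<^sup>2 / (\<rho>\<^sup>2 * \<gamma>\<^sub>0\<^sup>2) +
          (\<Sum>i=1..m. (norm (v i 0 - vbar i))\<^sup>2 / (\<rho>\<^sup>2 * \<gamma>\<^sub>0 * \<sigma> 0))))"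
proof -
  obtain n\<^sub>1 where n1: "\<gamma>\<^sub>0 < 1 \<Longrightarrow> n \<ge> n\<^sub>1 \<Longrightarrow> (real n * \<rho> * accelerated_step \<rho> \<gamma>\<^sub>0 n)\<^sup>2 \<le> 1 + \<epsilon>" for n
    using accelerated_step_asymptotics[of \<rho> \<gamma>\<^sub>0 \<epsilon>] assms by metis
  show ?thesis
  \<comment> \<open>At \<open>n = 0\<close> the right-hand side is \<open>0\<close> because of division by zero, hence the maximum
    with \<open>1\<close>.\<close>
  proof (rule exI[of _ "max 1 n\<^sub>1"], intro allI impI)
    fix m :: nat and \<mu> :: real and A :: "'h \<Rightarrow> 'h set" and C :: "'h \<Rightarrow> 'h" and z :: 'h
      and G :: "nat \<Rightarrow> 'g set" and B :: "nat \<Rightarrow> 'g \<Rightarrow> 'g set" and L :: "nat \<Rightarrow> 'h \<Rightarrow> 'g" and r :: "nat \<Rightarrow> 'g"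
      and xbar :: 'h and vbar :: "nat \<Rightarrow> 'g"
      and x :: "nat \<Rightarrow> 'h" and v :: "nat \<Rightarrow> nat \<Rightarrow> 'g" and p\<^sub>1 :: "nat \<Rightarrow> 'h" and p\<^sub>2 :: "nat \<Rightarrow> nat \<Rightarrow> 'g"
      and \<gamma> \<sigma> \<theta> :: "nat \<Rightarrow> real" and n :: nat
    assume m: "m \<ge> 1" and A: "maximally_monotone_op UNIV A" and \<mu>: "\<mu> > 0"
      and "monotone_op (op_of_fun C)" and C: "\<mu>-lipschitz_on UNIV C"
      and ops: "\<forall>i\<in>{1..m}. subspace (G i) \<and> closed (G i) \<and> r i \<in> G i \<and>
         maximally_monotone_op (G i) (B i) \<and>
         bounded_linear (L i) \<and> range (L i) \<subseteq> G i \<and> L i \<noteq> (\<lambda>_. 0)"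
      and strong: "strongly_monotone_op \<rho> (op_plus A (op_of_fun C))"
      and "\<forall>i\<in>{1..m}. vbar i \<in> G i"
      and xbar: "z - (\<Sum>i=1..m. adjoint (L i) (vbar i)) \<in> op_plus A (op_of_fun C) xbar"
      and vbar: "\<forall>i\<in>{1..m}. vbar i \<in> B i (L i xbar - r i)"
      and v0: "\<forall>i\<in>{1..m}. v i 0 \<in> G i"
      and small: "\<gamma>\<^sub>0 < min 1 (sqrt (1 + 4 * \<rho>) / (2 * (1 + 2 * \<rho>) * \<mu>))"
      and \<gamma>_0: "\<gamma> 0 = \<gamma>\<^sub>0"
      and \<sigma>_0: "\<sigma> 0 = 1 / (2 * \<gamma>\<^sub>0 * (1 + 2 * \<rho>) * (\<Sum>i=1..m. (onorm (L i))\<^sup>2))"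
      and p1: "\<forall>n. p\<^sub>1 n = resolvent (op_scale (\<gamma> n) A)
              (x n - \<gamma> n *\<^sub>R (C (x n) + (\<Sum>i=1..m. adjoint (L i) (v i n)) - z))"
      and p2: "\<forall>n. \<forall>i\<in>{1..m}. p\<^sub>2 i n = resolvent (op_scale (\<sigma> n) (op_inverse (B i)))
              (v i n + \<sigma> n *\<^sub>R (L i (x n) - r i))"
      and v_Suc: "\<forall>n. \<forall>i\<in>{1..m}. v i (Suc n) = \<sigma> n *\<^sub>R L i (p\<^sub>1 n - x n) + p\<^sub>2 i n"
      and x_Suc: "\<forall>n. x (Suc n) = \<gamma> n *\<^sub>R (\<Sum>i=1..m. adjoint (L i) (v i n - p\<^sub>2 i n))
              + \<gamma> n *\<^sub>R (C (x n) - C (p\<^sub>1 n)) + p\<^sub>1 n"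
      and steps: "\<forall>n. \<theta> n = 1 / sqrt (1 + 2 * \<rho> * \<gamma> n * (1 - \<gamma> n)) \<and>
           \<gamma> (Suc n) = \<theta> n * \<gamma> n \<and> \<sigma> (Suc n) = \<sigma> n / \<theta> n"
      and n: "max 1 n\<^sub>1 \<le> n"
    define \<Lambda> where "\<Lambda> = (\<Sum>i=1..m. (onorm (L i))\<^sup>2)"
    \<comment> \<open>The Lyapunov quantity: the weighted distance of the step inequality, divided by
      \<open>\<gamma> n\<close>.\<close>
    define V where "V n = (norm (x n - xbar))\<^sup>2 / (\<gamma> n)\<^sup>2
      + (\<Sum>i=1..m. (norm (v i n - vbar i))\<^sup>2) / (\<gamma> n * \<sigma> n)" for n

    have L: "bounded_linear (L i)" if "i \<in> {1..m}" for i using ops that by blast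
    have "\<Lambda> > 0"
      unfolding \<Lambda>_def
    proof (rule sum_pos)
      show "0 < (onorm (L i))\<^sup>2" if "i \<in> {1..m}" for i
        using onorm_pos_lt[OF L[OF that]] ops that by (auto simp: fun_eq_iff)
    qed (use m in auto)
    have \<gamma>0: "\<gamma>\<^sub>0 < 1" using small by simp
    have \<gamma>_eq: "\<gamma> n = accelerated_step \<rho> \<gamma>\<^sub>0 n" for n
      by (induction n) (simp_all add: \<gamma>_0 steps)
    have \<gamma>_pos: "0 < \<gamma> n" and \<gamma>_le: "\<gamma> n \<le> \<gamma>\<^sub>0" for n
      using accelerated_step_bounds[OF assms(1,2) \<gamma>0, of n] by (simp_all add: \<gamma>_eq)
    have \<gamma>_lt: "\<gamma> n < 1" for n using \<gamma>_le[of n] \<gamma>0 by linarith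
    have growth_pos: "0 < 1 + 2 * \<rho> * \<gamma> n * (1 - \<gamma> n)" for n
      using assms(1) \<gamma>_pos[of n] \<gamma>_lt[of n] by (intro add_pos_nonneg) auto
    have \<theta>_pos: "0 < \<theta> n" and \<theta>_sq: "1 / (\<theta> n)\<^sup>2 = 1 + 2 * \<rho> * \<gamma> n * (1 - \<gamma> n)" for n
      using steps growth_pos[of n] by (simp_all add: power_divide)
    have \<gamma>\<sigma>_Suc: "\<gamma> (Suc n) * \<sigma> (Suc n) = \<gamma> n * \<sigma> n" for n
      using steps \<theta>_pos[of n] by simp
    have \<gamma>\<sigma>: "\<gamma> n * \<sigma> n = 1 / (2 * (1 + 2 * \<rho>) * \<Lambda>)" for n
    proof (induction n)
      case 0
      show ?case using assms(2) by (simp add: \<gamma>_0 \<sigma>_0 \<Lambda>_def)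
    next
      case (Suc n)
      then show ?case by (simp only: \<gamma>\<sigma>_Suc)
    qed
    have \<gamma>\<sigma>_pos: "\<gamma> n * \<sigma> n > 0" for n
      unfolding \<gamma>\<sigma> using \<open>\<Lambda> > 0\<close> assms(1) by simp
    have \<sigma>_pos: "\<sigma> n > 0" for n using \<gamma>\<sigma>_pos \<gamma>_pos by (rule zero_less_mult_pos)

    have dual_point: "v i n + \<sigma> n *\<^sub>R (L i (x n) - r i) \<in> G i" if "v i n \<in> G i" "i \<in> {1..m}" for i n
      using ops that by (blast intro: subspace_add subspace_diff subspace_scale)
    have dual_resolvent: "p\<^sub>2 i n \<in> G i"
        "(1 / \<sigma> n) *\<^sub>R (v i n + \<sigma> n *\<^sub>R (L i (x n) - r i) - p\<^sub>2 i n) \<in> op_inverse (B i) (p\<^sub>2 i n)"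
      if "v i n \<in> G i" "i \<in> {1..m}" for i n
      using resolvent_scale_works[OF maximally_monotone_op_inverse _ _ dual_point[OF that] \<sigma>_pos, of "B i" n]
        ops p2 that by auto
    have v_in_G: "v i n \<in> G i" if i: "i \<in> {1..m}" for i n
    proof (induction n)
      case 0
      show ?case using v0 i by blast
    next
      case (Suc n)
      have "subspace (G i)" and "L i (p\<^sub>1 n - x n) \<in> G i" using ops i by blast+
      then show ?case
        using dual_resolvent(1)[OF Suc i] v_Suc i by (simp add: subspace_add subspace_scale)
    qed

    have V_Suc: "V (Suc n) \<le> V n" for n
    proof -
      have primal: "\<rho> * (norm (p\<^sub>1 n - xbar))\<^sup>2 \<le> (p\<^sub>1 n - xbar) \<bullet>
          ((1 / \<gamma> n) *\<^sub>R (x n - p\<^sub>1 n) - (C (x n) - C (p\<^sub>1 n))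
            - (\<Sum>i=1..m. adjoint (L i) (v i n)) + (\<Sum>i=1..m. adjoint (L i) (vbar i)))"
      proof -
        define S where "S = (\<Sum>i=1..m. adjoint (L i) (v i n))"
        have "(1 / \<gamma> n) *\<^sub>R (x n - \<gamma> n *\<^sub>R (C (x n) + S - z) - p\<^sub>1 n) \<in> A (p\<^sub>1 n)"
          using resolvent_scale_works(2)[OF A subspace_UNIV closed_UNIV UNIV_I \<gamma>_pos] p1
          unfolding S_def by simp
        moreover have "(1 / \<gamma> n) *\<^sub>R (x n - \<gamma> n *\<^sub>R (C (x n) + S - z) - p\<^sub>1 n)
            = (1 / \<gamma> n) *\<^sub>R (x n - p\<^sub>1 n) - C (x n) - S + z"
          using \<gamma>_pos[of n] by (simp add: algebra_simps)
        ultimately have "(1 / \<gamma> n) *\<^sub>R (x n - p\<^sub>1 n) - C (x n) - S + z + C (p\<^sub>1 n)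
            \<in> op_plus A (op_of_fun C) (p\<^sub>1 n)"
          by (auto simp: op_plus_def op_of_fun_def)
        then have "\<rho> * (norm (p\<^sub>1 n - xbar))\<^sup>2 \<le> (p\<^sub>1 n - xbar) \<bullet>
            ((1 / \<gamma> n) *\<^sub>R (x n - p\<^sub>1 n) - C (x n) - S + z + C (p\<^sub>1 n)
              - (z - (\<Sum>i=1..m. adjoint (L i) (vbar i))))"
          using strong xbar unfolding strongly_monotone_op_def by blast
        then show ?thesis by (simp add: S_def algebra_simps)
      qed
      have dual: "0 \<le> (p\<^sub>2 i n - vbar i) \<bullet> ((1 / \<sigma> n) *\<^sub>R (v i n - p\<^sub>2 i n) + L i (x n - xbar))"
        if i: "i \<in> {1..m}" for i
      proof -
        have "(1 / \<sigma> n) *\<^sub>R (v i n + \<sigma> n *\<^sub>R (L i (x n) - r i) - p\<^sub>2 i n) \<in> op_inverse (B i) (p\<^sub>2 i n)"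
          using dual_resolvent(2)[OF v_in_G[OF i] i] .
        moreover have "L i xbar - r i \<in> op_inverse (B i) (vbar i)"
          using vbar i by (auto simp: op_inverse_def)
        moreover have "monotone_op (op_inverse (B i))"
          using ops i maximally_monotone_op_inverse[of "G i" "B i"]
          by (auto simp: maximally_monotone_op_def)
        ultimately have "0 \<le> (p\<^sub>2 i n - vbar i) \<bullet>
            ((1 / \<sigma> n) *\<^sub>R (v i n + \<sigma> n *\<^sub>R (L i (x n) - r i) - p\<^sub>2 i n) - (L i xbar - r i))"
          unfolding monotone_op_def by blast
        also have "(1 / \<sigma> n) *\<^sub>R (v i n + \<sigma> n *\<^sub>R (L i (x n) - r i) - p\<^sub>2 i n) - (L i xbar - r i)
            = (1 / \<sigma> n) *\<^sub>R (v i n - p\<^sub>2 i n) + L i (x n - xbar)"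
          using \<sigma>_pos[of n]
          by (simp add: linear_diff[OF bounded_linear.linear[OF L[OF i]]] algebra_simps)
        finally show ?thesis .
      qed
      have "(1 + 2 * \<rho> * \<gamma> n * (1 - \<gamma> n)) * (norm (x (Suc n) - xbar))\<^sup>2 / \<gamma> n
          + (\<Sum>i=1..m. (norm (v i (Suc n) - vbar i))\<^sup>2) / \<sigma> n
        \<le> (norm (x n - xbar))\<^sup>2 / \<gamma> n + (\<Sum>i=1..m. (norm (v i n - vbar i))\<^sup>2) / \<sigma> n"
      proof (rule primal_dual_step[where c = "C (x n) - C (p\<^sub>1 n)" and v = "\<lambda>i. v i n"
            and q = "\<lambda>i. p\<^sub>2 i n" and b = vbar and p = "p\<^sub>1 n" and v' = "\<lambda>i. v i (Suc n)"
            and L = L and \<mu> = \<mu>])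
        show "\<gamma> n \<le> sqrt (1 + 4 * \<rho>) / (2 * (1 + 2 * \<rho>) * \<mu>)"
          using \<gamma>_le[of n] small by simp
        show "2 * (1 + 2 * \<rho>) * (\<Sum>i=1..m. (onorm (L i))\<^sup>2) * (\<gamma> n * \<sigma> n) = 1"
          unfolding \<gamma>\<sigma> \<Lambda>_def[symmetric] using \<open>\<Lambda> > 0\<close> assms(1) by simp
        show "norm (C (x n) - C (p\<^sub>1 n)) \<le> \<mu> * norm (x n - p\<^sub>1 n)"
          using lipschitz_onD[OF C UNIV_I UNIV_I] by (simp add: dist_norm)
      qed (use L assms \<gamma>_pos \<gamma>_lt \<mu> \<sigma>_pos primal dual v_Suc x_Suc in auto)
      \<comment> \<open>After division by \<open>\<gamma> n\<close> the gained factor is \<open>1 / (\<theta> n)\<^sup>2\<close> and turns \<open>\<gamma> n\<close> into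
        \<open>\<gamma> (Suc n)\<close>, while the dual weight \<open>\<gamma> n * \<sigma> n\<close> does not change at all.\<close>
      from divide_right_mono[OF this, of "\<gamma> n"]
      have "(1 + 2 * \<rho> * \<gamma> n * (1 - \<gamma> n)) * (norm (x (Suc n) - xbar))\<^sup>2 / (\<gamma> n)\<^sup>2
          + (\<Sum>i=1..m. (norm (v i (Suc n) - vbar i))\<^sup>2) / (\<gamma> n * \<sigma> n) \<le> V n"
        using \<gamma>_pos[of n]
        by (simp add: V_def add_divide_distrib power2_eq_square mult.commute[of "\<sigma> n"])
      moreover have "(1 + 2 * \<rho> * \<gamma> n * (1 - \<gamma> n)) * (norm (x (Suc n) - xbar))\<^sup>2 / (\<gamma> n)\<^sup>2
          = (norm (x (Suc n) - xbar))\<^sup>2 / (\<gamma> (Suc n))\<^sup>2"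
      proof -
        have "\<gamma> (Suc n) = \<theta> n * \<gamma> n" using steps by blast
        then show ?thesis unfolding \<theta>_sq[symmetric] by (simp add: power_mult_distrib)
      qed
      ultimately show ?thesis unfolding V_def[of "Suc n"] \<gamma>\<sigma>_Suc by simp
    qed
    have "V n \<le> V 0" by (induction n) (use V_Suc order_trans in blast)+
    moreover have "(norm (x n - xbar))\<^sup>2 / (\<gamma> n)\<^sup>2 \<le> V n"
      using \<gamma>\<sigma>_pos[of n] by (simp add: V_def sum_nonneg)
    ultimately have "(norm (x n - xbar))\<^sup>2 / (\<gamma> n)\<^sup>2 \<le> V 0" by (rule order_trans[rotated])
    then have "(norm (x n - xbar))\<^sup>2 \<le> (\<gamma> n)\<^sup>2 * V 0"
      using \<gamma>_pos[of n] by (simp add: pos_divide_le_eq ac_simps)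
    also have "\<dots> \<le> ((1 + \<epsilon>) / ((real n)\<^sup>2 * \<rho>\<^sup>2)) * V 0"
    proof (rule mult_right_mono)
      have "(real n * \<rho> * \<gamma> n)\<^sup>2 \<le> 1 + \<epsilon>" using n1[OF \<gamma>0, of n] n by (simp add: \<gamma>_eq)
      then show "(\<gamma> n)\<^sup>2 \<le> (1 + \<epsilon>) / ((real n)\<^sup>2 * \<rho>\<^sup>2)"
        using n assms(1) by (simp add: pos_le_divide_eq power_mult_distrib ac_simps)
      show "0 \<le> V 0" using \<gamma>\<sigma>_pos[of 0] by (simp add: V_def sum_nonneg)
    qed
    also have "\<dots> = (1 + \<epsilon>) / (real n)\<^sup>2 * ((norm (x 0 - xbar))\<^sup>2 / (\<rho>\<^sup>2 * \<gamma>\<^sub>0\<^sup>2) +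
          (\<Sum>i=1..m. (norm (v i 0 - vbar i))\<^sup>2 / (\<rho>\<^sup>2 * \<gamma>\<^sub>0 * \<sigma> 0)))"
    proof -
      have "V 0 / \<rho>\<^sup>2 = (norm (x 0 - xbar))\<^sup>2 / (\<rho>\<^sup>2 * \<gamma>\<^sub>0\<^sup>2) +
          (\<Sum>i=1..m. (norm (v i 0 - vbar i))\<^sup>2 / (\<rho>\<^sup>2 * \<gamma>\<^sub>0 * \<sigma> 0))"
        by (simp add: V_def \<gamma>_0 add_divide_distrib ac_simps flip: sum_divide_distrib)
      moreover have "(1 + \<epsilon>) / ((real n)\<^sup>2 * \<rho>\<^sup>2) * V 0 = (1 + \<epsilon>) / (real n)\<^sup>2 * (V 0 / \<rho>\<^sup>2)"
        by simp
      ultimately show ?thesis by (simp only:)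
    qed
    finally show "(norm (x n - xbar))\<^sup>2 \<le> (1 + \<epsilon>) / (real n)\<^sup>2 *
         ((norm (x 0 - xbar))\<^sup>2 / (\<rho>\<^sup>2 * \<gamma>\<^sub>0\<^sup>2) +
          (\<Sum>i=1..m. (norm (v i 0 - vbar i))\<^sup>2 / (\<rho>\<^sup>2 * \<gamma>\<^sub>0 * \<sigma> 0)))" .
  qed
qed

end
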